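(* Let $a,b,c$ be nonzero real numbers, and let $\{u_n\}$ and $\{v_n\}$ be the generalized bi-periodic Fibonacci and Lucas sequences. For any nonnegative integers $n,r$ and $m$ with $m>1$, $$u_{mn+r}=\frac{a^{1-\zeta(mn+r)}}{(ab)^{\lfloor \frac{mn+r}{2}\rfloor}}\sum_{i=0}^{n}\binom{n}{i}c^{\,n-i}u_m^{\,i}u_{m-1}^{\,n-i}u_{i+r}\,\delta[m,n,r,i],$$ $$v_{mn+r}=\frac{a^{1-\zeta(mn+r)}}{(ab)^{\lfloor \frac{mn+r}{2}\rfloor}}\sum_{i=0}^{n}\binom{n}{i}c^{\,n-i}u_m^{\,i}u_{m-1}^{\,n-i}v_{i+r}\,\delta[m,n,r,i],$$ where $$\delta[m,n,r,i]:=(ab)^{\lfloor \frac{i+r}{2}\rfloor+n\lfloor \frac m2\rfloor}\,a^{-\zeta(m+1)i-1+\zeta(i+r)}\,b^{\zeta(m)(n-i)}.$$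
   Context: For nonzero real numbers $a,b,c$, let $\chi(n)=a$ if $n$ is even and $\chi(n)=b$ if $n$ is odd. The generalized bi-periodic Fibonacci sequence $\{u_n\}$ is defined by $u_0=0$, $u_1=1$, $u_n=\chi(n)u_{n-1}+c\,u_{n-2}$ for $n\ge2$; the generalized bi-periodic Lucas sequence $\{v_n\}$ is defined by $v_0=2$, $v_1=b$ and $v_n=\chi(n)v_{n-1}+c\,v_{n-2}$ for $n\ge 2$. The parity function is $\zeta(n)=0$ if $n$ is even and $\zeta(n)=1$ if $n$ is odd. The convention $x^0=1$ (including $x=0$) is used. *)

theory Defs
  imports Complex_Main
begin

definition chi :: "real \<Rightarrow> real \<Rightarrow> nat \<Rightarrow> real" where
  "chi a b n = (if even n then a else b)"

fun bifib :: "real \<Rightarrow> real \<Rightarrow> real \<Rightarrow> nat \<Rightarrow> real" where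
  "bifib a b c 0 = 0"
| "bifib a b c (Suc 0) = 1"
| "bifib a b c (Suc (Suc n)) =
     chi a b (Suc (Suc n)) * bifib a b c (Suc n) + c * bifib a b c n"

fun biluc :: "real \<Rightarrow> real \<Rightarrow> real \<Rightarrow> nat \<Rightarrow> real" where
  "biluc a b c 0 = 2"
| "biluc a b c (Suc 0) = b"
| "biluc a b c (Suc (Suc n)) =
     chi a b (Suc (Suc n)) * biluc a b c (Suc n) + c * biluc a b c n"

(* Integer-valued, since it occurs in exponents that may be negative. *)
definition zeta :: "nat \<Rightarrow> int" where
  "zeta n = (if even n then 0 else 1)"

definition delta :: "real \<Rightarrow> real \<Rightarrow> nat \<Rightarrow> nat \<Rightarrow> nat \<Rightarrow> nat \<Rightarrow> real" where
  "delta a b m n r i =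
     (a * b) ^ ((i + r) div 2 + n * (m div 2))
     * a powi (- zeta (m + 1) * int i - 1 + zeta (i + r))
     * b powi (zeta m * (int n - int i))"

end

(* Rescaling a solution w of the bi-periodic recurrence to
   W k = (a b)^(k div 2) a^(zeta k - 1) w k turns it into a solution of the constant-coefficient
   recurrence W (k+2) = a b W (k+1) + a b c W k.  For such recurrences the addition formula
   W (m+j) = U m W (j+1) + a b c U (m-1) W j, with U the rescaled Fibonacci sequence, says that
   shifting by m is the operator U m S + a b c U (m-1), where S is the shift by one.  Its n-th power
   is expanded by the binomial theorem, and delta collects the rescaling factors. *)
theory Submission
  imports Defs
begin

text \<open>Pascal's rule in summed form. The two-argument \<open>h\<close> stands for a pair of
  exponents adding up to the degree: each term of degree \<open>n\<close> contributes once with the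
  first raised and once with the second.\<close>

lemma sum_choose_Suc:
  fixes h :: "nat \<Rightarrow> nat \<Rightarrow> 'a::comm_semiring_1"
  shows "(\<Sum>i\<le>Suc n. of_nat (Suc n choose i) * h i (Suc n - i)) =
    (\<Sum>i\<le>n. of_nat (n choose i) * (h (Suc i) (n - i) + h i (Suc n - i)))"
proof -
  have "(\<Sum>i\<le>Suc n. of_nat (Suc n choose i) * h i (Suc n - i)) =
      h 0 (Suc n) + (\<Sum>i\<le>n. of_nat (Suc n choose Suc i) * h (Suc i) (n - i))"
    by (subst sum.atMost_Suc_shift) simp
  also have "\<dots> = (\<Sum>i\<le>n. of_nat (n choose i) * h (Suc i) (n - i)) +
      (h 0 (Suc n) + (\<Sum>i\<le>n. of_nat (n choose Suc i) * h (Suc i) (n - i)))"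
    by (simp add: distrib_right sum.distrib algebra_simps)
  \<comment> \<open>The isolated term is the one at index 0. The sum regained runs to
    \<open>Suc n\<close>, where the binomial coefficient vanishes.\<close>
  also have "h 0 (Suc n) + (\<Sum>i\<le>n. of_nat (n choose Suc i) * h (Suc i) (n - i)) =
      (\<Sum>i\<le>Suc n. of_nat (n choose i) * h i (Suc n - i))"
    by (subst sum.atMost_Suc_shift) simp
  also have "\<dots> = (\<Sum>i\<le>n. of_nat (n choose i) * h i (Suc n - i))"
    by (simp add: binomial_eq_0)
  finally show ?thesis
    by (simp add: distrib_left sum.distrib)
qed

text \<open>Each induction step trades one unit of \<open>m\<close> for one of \<open>j\<close>, so
  \<open>j\<close> must stay arbitrary.\<close>

lemma linear_recurrence_add:
  fixes W U :: "nat \<Rightarrow> 'a::comm_semiring_1"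
  assumes W: "\<And>k. W (Suc (Suc k)) = p * W (Suc k) + q * W k"
    and U: "\<And>k. U (Suc (Suc k)) = p * U (Suc k) + q * U k"
    and "U 0 = 0" "U (Suc 0) = 1"
  shows "W (Suc m + j) = U (Suc m) * W (Suc j) + q * U m * W j"
proof (induction m arbitrary: j)
  case 0
  then show ?case using assms by simp
next
  case (Suc m)
  have "W (Suc (Suc m) + j) = W (Suc m + Suc j)" by simp
  also have "\<dots> = U (Suc m) * W (Suc (Suc j)) + q * U m * W (Suc j)" by (rule Suc)
  also have "\<dots> = U (Suc (Suc m)) * W (Suc j) + q * U (Suc m) * W j"
    by (simp add: W U algebra_simps)
  finally show ?case .
qed

text \<open>Induction on \<open>n\<close> with \<open>r\<close> free: one block of length
  \<open>m\<close> is absorbed into the offset, and \<open>shift\<close> splits each term in two, as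
  Pascal's rule requires.\<close>

lemma binomial_shift_expansion:
  fixes W :: "nat \<Rightarrow> 'a::comm_semiring_1"
  assumes shift: "\<And>j. W (m + j) = x * W (Suc j) + y * W j"
  shows "W (m * n + r) = (\<Sum>i\<le>n. of_nat (n choose i) * (x ^ i * y ^ (n - i) * W (i + r)))"
proof (induction n arbitrary: r)
  case 0
  show ?case by simp
next
  case (Suc n)
  have "W (m * Suc n + r) = W (m * n + (m + r))" by (simp add: algebra_simps)
  also have "\<dots> = (\<Sum>i\<le>n. of_nat (n choose i) * (x ^ i * y ^ (n - i) * W (i + (m + r))))"
    by (rule Suc)
  also have "\<dots> = (\<Sum>i\<le>n. of_nat (n choose i) *
      (x ^ Suc i * y ^ (n - i) * W (Suc i + r) + x ^ i * y ^ (Suc n - i) * W (i + r)))"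
  proof (rule sum.cong)
    fix i assume "i \<in> {..n}"
    then have "y ^ (Suc n - i) = y * y ^ (n - i)" by (simp add: Suc_diff_le)
    moreover have "W (i + (m + r)) = x * W (Suc i + r) + y * W (i + r)"
      using shift[of "i + r"] by (simp add: algebra_simps)
    ultimately show "of_nat (n choose i) * (x ^ i * y ^ (n - i) * W (i + (m + r))) =
        of_nat (n choose i) *
        (x ^ Suc i * y ^ (n - i) * W (Suc i + r) + x ^ i * y ^ (Suc n - i) * W (i + r))"
      by (simp add: algebra_simps)
  qed simp
  also have "\<dots> = (\<Sum>i\<le>Suc n. of_nat (Suc n choose i) * (x ^ i * y ^ (Suc n - i) * W (i + r)))"
    by (rule sum_choose_Suc[symmetric])
  finally show ?case .
qed

definition scale :: "real \<Rightarrow> real \<Rightarrow> nat \<Rightarrow> real" where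
  "scale a b k = (a * b) ^ (k div 2) * a powi (zeta k - 1)"

lemma scale_even: "scale a b (2 * k) = (a * b) ^ k / a"
  by (simp add: scale_def zeta_def power_int_minus divide_inverse)

lemma scale_odd: "scale a b (Suc (2 * k)) = (a * b) ^ k"
  by (simp add: scale_def zeta_def)

text \<open>From k+1 to k+2 the scale gains whichever of \<open>a\<close>, \<open>b\<close> is not
  the value of \<open>chi\<close> at k+2, so their product is always \<open>a * b\<close>. Two steps
  together also gain \<open>a * b\<close>.\<close>

lemma scale_recurrence:
  assumes "a \<noteq> 0"
    and w: "w (Suc (Suc k)) = chi a b (Suc (Suc k)) * w (Suc k) + c * w k"
  shows "scale a b (Suc (Suc k)) * w (Suc (Suc k)) =
    a * b * (scale a b (Suc k) * w (Suc k)) + a * b * c * (scale a b k * w k)"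
proof (cases "even k")
  case True
  then obtain l where l: "k = 2 * l" by (rule evenE)
  show ?thesis
    using \<open>a \<noteq> 0\<close> scale_even[of a b "Suc l"]
    by (simp add: w[unfolded l] l chi_def scale_even scale_odd) (simp add: field_simps)
next
  case False
  then obtain l where l: "k = Suc (2 * l)" by (metis oddE Suc_eq_plus1)
  show ?thesis
    using \<open>a \<noteq> 0\<close> scale_even[of a b "Suc l"] scale_odd[of a b "Suc l"]
    by (simp add: w[unfolded l] l chi_def scale_odd) (simp add: field_simps)
qed

text \<open>The prefactor in the theorem is what undoes the rescaling at index
  \<open>k\<close>.\<close>

lemma inverse_scale:
  assumes "a \<noteq> 0" "b \<noteq> 0"
  shows "a powi (1 - zeta k) / (a * b) ^ (k div 2) * scale a b k = 1"
  using assms by (simp add: scale_def flip: power_int_add)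

text \<open>These are the scales of all factors in one term of the expansion. The powers of
  \<open>(a * b)\<close> common to both bases combine to exponent \<open>n\<close>. What remains is
  \<open>b\<close> to the power \<open>n - i\<close> if \<open>Suc m\<close> is odd, and
  \<open>1 / a\<close> to the power \<open>i\<close> if it is even.\<close>

lemma scale_powers_eq_delta:
  assumes "a \<noteq> 0" "b \<noteq> 0" "i \<le> n"
  shows "scale a b (Suc m) ^ i * (a * b * scale a b m) ^ (n - i) * scale a b (i + r) =
    delta a b (Suc m) n r i"
proof -
  have "scale a b (Suc m) ^ i * (a * b * scale a b m) ^ (n - i) =
      (a * b) ^ (n * (Suc m div 2)) * a powi (- zeta (Suc m + 1) * int i) *
      b powi (zeta (Suc m) * (int n - int i))"
  proof (cases "even m")
    case True
    then obtain l where l: "m = 2 * l" by (rule evenE)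
    have "scale a b (Suc m) ^ i * (a * b * scale a b m) ^ (n - i) =
        ((a * b) ^ l) ^ i * ((a * b) ^ l * b) ^ (n - i)"
      using \<open>a \<noteq> 0\<close> by (simp add: l scale_even scale_odd) (simp add: mult_ac)
    also have "\<dots> = ((a * b) ^ l) ^ n * b ^ (n - i)"
      using \<open>i \<le> n\<close> by (simp add: power_mult_distrib[of _ b] flip: power_add mult.assoc)
    also have "\<dots> = (a * b) ^ (n * l) * b powi (int n - int i)"
      using \<open>i \<le> n\<close> by (simp add: power_mult mult.commute[of n] flip: of_nat_diff)
    finally show ?thesis by (simp add: l zeta_def)
  next
    case False
    then obtain l where l: "m = Suc (2 * l)" by (metis oddE Suc_eq_plus1)
    have "scale a b (Suc m) ^ i * (a * b * scale a b m) ^ (n - i) =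
        ((a * b) ^ Suc l / a) ^ i * ((a * b) ^ Suc l) ^ (n - i)"
      using scale_even[of a b "Suc l"] by (simp add: l scale_odd)
    also have "\<dots> = ((a * b) ^ Suc l) ^ n / a ^ i"
      using \<open>i \<le> n\<close> by (simp only: power_divide times_divide_eq_left le_add_diff_inverse flip: power_add)
    also have "\<dots> = (a * b) ^ (n * Suc l) * a powi (- int i)"
      by (simp only: power_mult[symmetric] power_int_minus power_int_of_nat divide_inverse mult.commute[of n])
    finally show ?thesis by (simp add: l zeta_def)
  qed
  \<comment> \<open>The factor split off belongs to \<open>scale a b (i + r)\<close>.\<close>
  moreover have "a powi (- zeta (Suc m + 1) * int i - 1 + zeta (i + r)) =
      a powi (- zeta (Suc m + 1) * int i) * a powi (zeta (i + r) - 1)"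
    using \<open>a \<noteq> 0\<close> by (simp flip: power_int_add add: algebra_simps)
  ultimately show ?thesis
    by (simp add: scale_def delta_def power_add)
qed

text \<open>No initial values of \<open>w\<close> are fixed, so the Fibonacci and Lucas identities
  are both instances.\<close>

lemma biperiodic_expansion:
  assumes "a \<noteq> 0" "b \<noteq> 0" "m > 0"
    and w: "\<And>k. w (Suc (Suc k)) = chi a b (Suc (Suc k)) * w (Suc k) + c * w k"
  shows "w (m * n + r) =
    a powi (1 - zeta (m * n + r)) / (a * b) ^ ((m * n + r) div 2) *
    (\<Sum>i = 0..n. real (n choose i) * c ^ (n - i) * bifib a b c m ^ i
       * bifib a b c (m - 1) ^ (n - i) * w (i + r) * delta a b m n r i)"
proof -
  obtain l where m: "m = Suc l" using \<open>m > 0\<close> gr0_conv_Suc by blast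
  define W where "W k = scale a b k * w k" for k
  define U where "U k = scale a b k * bifib a b c k" for k
  have W: "W (Suc (Suc k)) = a * b * W (Suc k) + a * b * c * W k" for k
    unfolding W_def by (rule scale_recurrence[OF \<open>a \<noteq> 0\<close> w])
  have U: "U (Suc (Suc k)) = a * b * U (Suc k) + a * b * c * U k" for k
    unfolding U_def by (rule scale_recurrence[where w = "bifib a b c"]) (simp_all add: \<open>a \<noteq> 0\<close>)
  \<comment> \<open>The scale is normalised to 1 at index 1, so \<open>U\<close> keeps the initial
    values 0 and 1 that the addition formula needs.\<close>
  have "U 0 = 0" "U (Suc 0) = 1"
    using scale_odd[of a b 0] by (simp_all add: U_def)
  then have "W (m + j) = U m * W (Suc j) + a * b * c * U l * W j" for j
    unfolding m by (intro linear_recurrence_add[where p = "a * b"] W U)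
  then have "W (m * n + r) =
      (\<Sum>i\<le>n. real (n choose i) * (U m ^ i * (a * b * c * U l) ^ (n - i) * W (i + r)))"
    by (rule binomial_shift_expansion)
  also have "\<dots> = (\<Sum>i = 0..n. real (n choose i) * c ^ (n - i) * bifib a b c m ^ i
       * bifib a b c (m - 1) ^ (n - i) * w (i + r) * delta a b m n r i)"
    unfolding atLeast0AtMost
  proof (rule sum.cong)
    fix i assume "i \<in> {..n}"
    then have "delta a b m n r i =
        scale a b m ^ i * (a * b * scale a b l) ^ (n - i) * scale a b (i + r)"
      using scale_powers_eq_delta[of a b i n l r] assms by (simp add: m)
    then show "real (n choose i) * (U m ^ i * (a * b * c * U l) ^ (n - i) * W (i + r)) =
        real (n choose i) * c ^ (n - i) * bifib a b c m ^ i
          * bifib a b c (m - 1) ^ (n - i) * w (i + r) * delta a b m n r i"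
      by (simp add: U_def W_def m power_mult_distrib mult_ac)
  qed simp
  finally show ?thesis
    using inverse_scale[OF assms(1,2), of "m * n + r"]
    by (metis W_def mult.assoc mult_1)
qed

theorem theorem2:
  fixes a b c :: real and m n r :: nat
  assumes "a \<noteq> 0" and "b \<noteq> 0" and "c \<noteq> 0" and "m > 1"
  shows "bifib a b c (m * n + r) =
      a powi (1 - zeta (m * n + r)) / (a * b) ^ ((m * n + r) div 2) *
      (\<Sum>i = 0..n. real (n choose i) * c ^ (n - i) * bifib a b c m ^ i
         * bifib a b c (m - 1) ^ (n - i) * bifib a b c (i + r) * delta a b m n r i)
    \<and> biluc a b c (m * n + r) =
      a powi (1 - zeta (m * n + r)) / (a * b) ^ ((m * n + r) div 2) *
      (\<Sum>i = 0..n. real (n choose i) * c ^ (n - i) * bifib a b c m ^ i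
         * bifib a b c (m - 1) ^ (n - i) * biluc a b c (i + r) * delta a b m n r i)"
  by (intro conjI biperiodic_expansion) (use assms in simp_all)

end
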